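(* Let $A,B$ be positive definite $n\times n$ complex matrices, $N\in\mathbb{N}$ (with $N\ge 1$) and $0\leq\nu\leq 1$. Put $\alpha_j(\nu)=\frac{k_j(\nu)}{2^{j-1}}$. Then $$A\#_{\nu}B+\sum_{j=1}^{N}s_{j}(\nu)\left(A\#_{\alpha_j(\nu)}B+A\#_{2^{1-j}+\alpha_j(\nu)}B-2\,A\#_{2^{-j}+\alpha_j(\nu)}B\right)\leq A\nabla_{\nu}B .$$
   Context: $[x]$ denotes the greatest integer $\le x$. For $\nu\in[0,1]$ and $j\geq 1$ put $k_j(\nu)=[2^{j-1}\nu]$, $r_j(\nu)=[2^{j}\nu]$ and $s_j(\nu)=(-1)^{r_j(\nu)}2^{j-1}\nu+(-1)^{r_j(\nu)+1}\left[\frac{r_j(\nu)+1}{2}\right]$. For positive definite matrices $A,B$ and $t\in\mathbb{R}$, $A\nabla_{t}B=(1-t)A+tB$ and $A\#_tB=A^{1/2}\left(A^{-1/2}BA^{-1/2}\right)^{t}A^{1/2}$. For Hermitian matrices, $X\le Y$ means that $Y-X$ is positive semidefinite. *)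

theory Defs
  imports "HOL-Analysis.Analysis"
begin

section \<open>Complex matrices\<close>

definition ctranspose :: "complex^'n^'m \<Rightarrow> complex^'m^'n" where
  "ctranspose A = (\<chi> i j. cnj (A $ j $ i))"

definition hermitian :: "complex^'n^'n \<Rightarrow> bool" where
  "hermitian A \<longleftrightarrow> ctranspose A = A"

definition unitary :: "complex^'n^'n \<Rightarrow> bool" where
  "unitary U \<longleftrightarrow> ctranspose U ** U = mat 1 \<and> U ** ctranspose U = mat 1"

definition quad_form :: "complex^'n^'n \<Rightarrow> complex^'n \<Rightarrow> complex" where
  "quad_form A x = (\<Sum>i\<in>UNIV. cnj (x $ i) * (A *v x) $ i)"

text \<open>The quadratic form of a Hermitian matrix is real-valued, so taking the real part
  loses nothing.\<close>

definition pos_semidef :: "complex^'n^'n \<Rightarrow> bool" where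
  "pos_semidef A \<longleftrightarrow> hermitian A \<and> (\<forall>x. 0 \<le> Re (quad_form A x))"

definition pos_def :: "complex^'n^'n \<Rightarrow> bool" where
  "pos_def A \<longleftrightarrow> hermitian A \<and> (\<forall>x. x \<noteq> 0 \<longrightarrow> 0 < Re (quad_form A x))"

definition loewner_le :: "complex^'n^'n \<Rightarrow> complex^'n^'n \<Rightarrow> bool"  (infix \<open>\<preceq>\<^sub>L\<close> 50) where
  "X \<preceq>\<^sub>L Y \<longleftrightarrow> pos_semidef (Y - X)"

definition diag_matrix :: "('n \<Rightarrow> real) \<Rightarrow> complex^'n^'n" where
  "diag_matrix d = (\<chi> i j. if i = j then complex_of_real (d i) else 0)"

text \<open>Real powers of a positive definite matrix by functional calculus: if
  \<open>A = U diag(d) U\<^sup>*\<close> with \<open>U\<close> unitary, then \<open>A\<^sup>t = U diag(d\<^sup>t) U\<^sup>*\<close>, which does not depend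
  on the chosen diagonalization. The value is meaningful only for positive definite \<open>A\<close>.\<close>

definition mat_powr :: "complex^'n^'n \<Rightarrow> real \<Rightarrow> complex^'n^'n" where
  "mat_powr A t = (THE X. \<exists>U d. unitary U \<and> (\<forall>i. 0 < d i) \<and>
      A = U ** diag_matrix d ** ctranspose U \<and>
      X = U ** diag_matrix (\<lambda>i. d i powr t) ** ctranspose U)"

definition arith_mean :: "complex^'n^'n \<Rightarrow> real \<Rightarrow> complex^'n^'n \<Rightarrow> complex^'n^'n"
    (\<open>(_ \<nabla>\<^bsub>_\<^esub> _)\<close> [76, 0, 76] 75) where
  "A \<nabla>\<^bsub>t\<^esub> B = (1 - t) *\<^sub>R A + t *\<^sub>R B"

definition geom_mean :: "complex^'n^'n \<Rightarrow> real \<Rightarrow> complex^'n^'n \<Rightarrow> complex^'n^'n"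
    (\<open>(_ \<sharp>\<^bsub>_\<^esub> _)\<close> [76, 0, 76] 75) where
  "A \<sharp>\<^bsub>t\<^esub> B =
     mat_powr A (1/2) ** mat_powr (mat_powr A (-1/2) ** B ** mat_powr A (-1/2)) t ** mat_powr A (1/2)"


section \<open>The dyadic coefficients\<close>

text \<open>All of the following are intended for \<open>j \<ge> 1\<close>, where the subtraction \<open>j - 1\<close> on
  natural numbers does not truncate.\<close>

definition k_coeff :: "nat \<Rightarrow> real \<Rightarrow> int" where
  "k_coeff j \<nu> = \<lfloor>2 ^ (j - 1) * \<nu>\<rfloor>"

definition r_coeff :: "nat \<Rightarrow> real \<Rightarrow> int" where
  "r_coeff j \<nu> = \<lfloor>2 ^ j * \<nu>\<rfloor>"

definition s_coeff :: "nat \<Rightarrow> real \<Rightarrow> real" where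
  "s_coeff j \<nu> = (-1) powi (r_coeff j \<nu>) * 2 ^ (j - 1) * \<nu>
     + (-1) powi (r_coeff j \<nu> + 1) * of_int \<lfloor>(of_int (r_coeff j \<nu>) + 1) / (2::real)\<rfloor>"

definition alpha :: "nat \<Rightarrow> real \<Rightarrow> real" where
  "alpha j \<nu> = of_int (k_coeff j \<nu>) / 2 ^ (j - 1)"

end

(* Let f_n be the piecewise linear interpolation of a convex function f at the dyadic points
   k / 2^n. The j-th term of the sum is f_(j-1)(nu) - f_j(nu), since s_j(nu) is the distance of
   2^(j-1) nu to the nearest integer. The sum telescopes to f_0(nu) - f_N(nu), and f <= f_N by
   convexity. This is applied to f(t) = x powr t. A congruence turns A into the identity and B
   into a diagonal matrix, so that the matrix inequality is the scalar one for every diagonal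
   entry x. *)

theory Submission
  imports Defs
begin

section \<open>Dyadic interpolation\<close>

text \<open>At a dyadic point \<open>k / 2 ^ n\<close> the right node has weight 0, so for
  \<open>\<nu> = 1\<close> the value of \<open>f\<close> beyond 1 does not count.\<close>

definition dyadic_interp :: "(real \<Rightarrow> real) \<Rightarrow> nat \<Rightarrow> real \<Rightarrow> real" where
  "dyadic_interp f n \<nu> = (1 - frac (2 ^ n * \<nu>)) * f (\<lfloor>2 ^ n * \<nu>\<rfloor> / 2 ^ n)
     + frac (2 ^ n * \<nu>) * f ((\<lfloor>2 ^ n * \<nu>\<rfloor> + 1) / 2 ^ n)"

text \<open>Refining the dyadic grid doubles \<open>2 ^ n * \<nu>\<close>; whether the old
  fractional part is below 1/2 tells which half of the old cell contains \<nu>.\<close>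

lemma floor_double:
  fixes y :: real
  shows "\<lfloor>2 * y\<rfloor> = (if frac y < 1/2 then 2 * \<lfloor>y\<rfloor> else 2 * \<lfloor>y\<rfloor> + 1)"
proof -
  have "y = \<lfloor>y\<rfloor> + frac y" by (simp add: frac_def)
  moreover have "0 \<le> frac y" "frac y < 1" by (simp_all add: frac_lt_1)
  ultimately show ?thesis by (auto simp: floor_eq_iff; linarith)
qed

lemma frac_double:
  fixes y :: real
  shows "frac (2 * y) = (if frac y < 1/2 then 2 * frac y else 2 * frac y - 1)"
  unfolding frac_def[of "2 * y"] floor_double by (auto simp: frac_def)

text \<open>Let k be the floor of y = 2^n \<nu>. For even r = 2k the sign of y is + and the bracket
  is k; for odd r = 2k + 1 the sign is - and the bracket is k + 1. The index \<open>Suc n\<close>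
  avoids truncated subtraction.\<close>

lemma s_coeff_Suc:
  "s_coeff (Suc n) \<nu> = (let u = frac (2 ^ n * \<nu>) in if u < 1/2 then u else 1 - u)"
proof -
  let ?y = "2 ^ n * \<nu>"
  have r: "r_coeff (Suc n) \<nu> = \<lfloor>2 * ?y\<rfloor>" by (simp add: r_coeff_def mult.assoc)
  have sgn: "(-1::real) powi (2 * k) = 1" "(-1::real) powi (2 * k + 1) = -1"
    "(-1::real) powi (2 * k + 2) = 1" for k :: int
    by (simp_all add: power_int_minus_left)
  show ?thesis
  proof (cases "frac ?y < 1/2")
    case True
    have "\<lfloor>(real_of_int (2 * k) + 1) / 2\<rfloor> = k" for k by (rule floor_unique) auto
    with True show ?thesis
      by (simp add: s_coeff_def r floor_double sgn) (simp add: frac_def Let_def)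
  next
    case False
    have "\<lfloor>(real_of_int (2 * k + 1) + 1) / 2\<rfloor> = k + 1" for k by (rule floor_unique) auto
    with False show ?thesis
      by (simp add: s_coeff_def r floor_double sgn add.assoc) (simp add: frac_def Let_def)
  qed
qed

text \<open>The three points are the left end, right end and midpoint of the level-n cell. In its
  left half the weights (1 - u, u) on the two ends become (1 - 2u, 2u) on left end and midpoint, so
  the difference is u times the second difference of \<open>f\<close>. The right half is symmetric,
  with 1 - u for u.\<close>

lemma dyadic_interp_diff:
  "dyadic_interp f n \<nu> - dyadic_interp f (Suc n) \<nu>
   = s_coeff (Suc n) \<nu> * (f (alpha (Suc n) \<nu>) + f (2 powi (1 - int (Suc n)) + alpha (Suc n) \<nu>)
       - 2 * f (2 powi (- int (Suc n)) + alpha (Suc n) \<nu>))"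
proof -
  let ?y = "2 ^ n * \<nu>"
  define k u where "k = \<lfloor>?y\<rfloor>" and "u = frac ?y"
  have a: "alpha (Suc n) \<nu> = k / 2 ^ n"
    by (simp add: alpha_def k_coeff_def k_def)
  have b: "2 powi (1 - int (Suc n)) + k / 2 ^ n = (k + 1) / 2 ^ n"
    by (simp add: power_int_minus field_simps)
  have p: "(2::real) powi (- int (Suc n)) = 1 / (2 * 2 ^ n)"
    by (simp only: power_int_minus power_int_of_nat) (simp add: field_simps)
  have c: "2 powi (- int (Suc n)) + k / 2 ^ n = (2 * k + 1) / (2 * 2 ^ n)"
    unfolding p by (simp add: field_simps)
  \<comment> \<open>In the right half, the upper node of the refined grid has to be recognised as
    the right end of the old cell.\<close>
  have d: "(2 * k + 2) / (2 * 2 ^ n) = (k + 1) / (2 ^ n :: real)"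
    by (simp add: field_simps)
  have e: "2 ^ Suc n * \<nu> = 2 * ?y" by simp
  show ?thesis
    unfolding a b c s_coeff_Suc dyadic_interp_def e floor_double frac_double
    unfolding k_def[symmetric] u_def[symmetric]
    using d by (simp add: Let_def add.assoc) (auto simp: algebra_simps)
qed

text \<open>\<nu> is the convex combination of its two neighbouring nodes with the interpolation
  weights, so this is Jensen's inequality for two points.\<close>

lemma convex_le_dyadic_interp:
  assumes "convex_on UNIV f"
  shows "f \<nu> \<le> dyadic_interp f n \<nu>"
proof -
  let ?y = "2 ^ n * \<nu>"
  have "f ((1 - frac ?y) *\<^sub>R (\<lfloor>?y\<rfloor> / 2 ^ n) + frac ?y *\<^sub>R ((\<lfloor>?y\<rfloor> + 1) / 2 ^ n))
      \<le> (1 - frac ?y) * f (\<lfloor>?y\<rfloor> / 2 ^ n) + frac ?y * f ((\<lfloor>?y\<rfloor> + 1) / 2 ^ n)"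
    using frac_lt_1[of ?y] by (intro convex_onD[OF assms]) auto
  moreover have "(1 - frac ?y) *\<^sub>R (\<lfloor>?y\<rfloor> / 2 ^ n) + frac ?y *\<^sub>R ((\<lfloor>?y\<rfloor> + 1) / 2 ^ n) = \<nu>"
    by (simp add: frac_def field_simps)
  ultimately show ?thesis by (simp add: dyadic_interp_def)
qed

lemma dyadic_interp_0:
  assumes "0 \<le> \<nu>" "\<nu> \<le> 1"
  shows "dyadic_interp f 0 \<nu> = (1 - \<nu>) * f 0 + \<nu> * f 1"
\<comment> \<open>At \<open>\<nu> = 1\<close> the cell is [1, 2] instead of [0, 1]; its left node
  gives \<open>f 1\<close> with weight 1.\<close>
proof (cases "\<nu> = 1")
  case False
  with assms have "\<lfloor>\<nu>\<rfloor> = 0" by linarith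
  then show ?thesis by (simp add: dyadic_interp_def frac_def)
qed (simp add: dyadic_interp_def)

lemma dyadic_convex_le:
  assumes "convex_on UNIV f" "0 \<le> \<nu>" "\<nu> \<le> 1"
  shows "f \<nu> + (\<Sum>j=1..N. s_coeff j \<nu> *
      (f (alpha j \<nu>) + f (2 powi (1 - int j) + alpha j \<nu>)
       - 2 * f (2 powi (- int j) + alpha j \<nu>))) \<le> (1 - \<nu>) * f 0 + \<nu> * f 1"
proof -
  have "(\<Sum>j=1..N. s_coeff j \<nu> *
      (f (alpha j \<nu>) + f (2 powi (1 - int j) + alpha j \<nu>)
       - 2 * f (2 powi (- int j) + alpha j \<nu>)))
      = dyadic_interp f 0 \<nu> - dyadic_interp f N \<nu>"
    by (induction N) (simp_all add: dyadic_interp_diff[symmetric] del: of_nat_Suc)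
  then show ?thesis
    using convex_le_dyadic_interp[OF assms(1), of \<nu> N] dyadic_interp_0[OF assms(2,3), of f] by simp
qed

text \<open>As a function of t, this is exp composed with the linear map t * ln x.\<close>

lemma convex_on_powr_exponent:
  fixes x :: real
  assumes "0 < x"
  shows "convex_on UNIV (\<lambda>t. x powr t)"
proof (rule convex_onI)
  fix t a b :: real assume "0 < t" "t < 1"
  then have "exp ((1 - t) *\<^sub>R (a * ln x) + t *\<^sub>R (b * ln x))
      \<le> (1 - t) * exp (a * ln x) + t * exp (b * ln x)"
    by (intro convex_onD[OF exp_convex]) auto
  then show "x powr ((1 - t) *\<^sub>R a + t *\<^sub>R b) \<le> (1 - t) * x powr a + t * x powr b"
    using assms by (simp add: powr_def algebra_simps)
qed simp

section \<open>The spectral theorem for Hermitian matrices\<close>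

lemma inner_complex_eq: "inner (a::complex) b = Re (cnj a * b)"
  by (simp add: inner_complex_def)

text \<open>Positivity becomes a statement about the real inner product, so that the theory of
  Euclidean spaces applies.\<close>

lemma Re_quad_form: "Re (quad_form A x) = inner x (A *v x)"
  by (simp add: quad_form_def inner_vec_def inner_complex_eq)

lemma inner_ctranspose: "inner (A *v x) y = inner x (ctranspose A *v y)"
proof -
  have "inner (A *v x) y = Re (\<Sum>i\<in>UNIV. \<Sum>j\<in>UNIV. cnj (A $ i $ j) * cnj (x $ j) * y $ i)"
    by (simp add: inner_vec_def inner_complex_eq matrix_vector_mult_def sum_distrib_right
        del: Re_sum flip: Re_sum)
  also have "\<dots> = Re (\<Sum>j\<in>UNIV. \<Sum>i\<in>UNIV. cnj (A $ i $ j) * cnj (x $ j) * y $ i)"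
    by (subst sum.swap) simp
  also have "\<dots> = inner x (ctranspose A *v y)"
    by (simp add: inner_vec_def inner_complex_eq matrix_vector_mult_def sum_distrib_left
        ctranspose_def mult_ac del: Re_sum flip: Re_sum)
  finally show ?thesis .
qed

lemma ctranspose_ctranspose [simp]: "ctranspose (ctranspose A) = A"
  by (simp add: ctranspose_def vec_eq_iff)

lemma ctranspose_mult: "ctranspose (A ** B) = ctranspose B ** ctranspose A"
  by (simp add: ctranspose_def matrix_matrix_mult_def vec_eq_iff mult.commute)

lemma ctranspose_diag_matrix [simp]: "ctranspose (diag_matrix d) = diag_matrix d"
  by (auto simp: ctranspose_def diag_matrix_def vec_eq_iff)

lemma hermitian_inner: "hermitian A \<Longrightarrow> inner (A *v x) y = inner x (A *v y)"
  by (simp add: inner_ctranspose hermitian_def)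

lemma mult_diag_matrix_nth: "(M ** diag_matrix d) $ i $ j = M $ i $ j * complex_of_real (d j)"
  by (simp add: matrix_matrix_mult_def diag_matrix_def mult_delta_right)

lemma diag_matrix_mult_nth: "(diag_matrix d ** M) $ i $ j = complex_of_real (d i) * M $ i $ j"
  by (simp add: matrix_matrix_mult_def diag_matrix_def mult_delta_left)

lemma matrix_vector_mult_scaleR: "A *v (c *\<^sub>R x) = c *\<^sub>R (A *v (x::complex^'n))"
  by (simp add: matrix_vector_mult_def vec_eq_iff scaleR_sum_right)

text \<open>Near t = 0 a nonzero linear term would outweigh the quadratic one. This is the
  first-order condition at an extremum.\<close>

lemma quadratic_nonneg_imp_linear_coeff_0:
  fixes c p :: real
  assumes "0 \<le> p" "\<And>t. 0 \<le> 2 * t * c + t\<^sup>2 * p"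
  shows "c = 0"
proof (rule ccontr)
  assume "c \<noteq> 0"
  \<comment> \<open>The minimizer would be -c/p; the denominator p + 1 cannot vanish and turns the
    expression into -t^2 (p + 2).\<close>
  define t where "t = - c / (p + 1)"
  have "c = - t * (p + 1)" using assms(1) by (simp add: t_def)
  moreover from this \<open>c \<noteq> 0\<close> have "t \<noteq> 0" by auto
  ultimately have "2 * t * c + t\<^sup>2 * p = - (t\<^sup>2 * (p + 2))" by algebra
  moreover have "0 < t\<^sup>2 * (p + 2)" using \<open>t \<noteq> 0\<close> assms(1) by simp
  ultimately show False using assms(2)[of t] by linarith
qed

text \<open>A maximizer of the quadratic form on the unit sphere of an invariant subspace is an
  eigenvector.\<close>

lemma hermitian_eigenvector_in_subspace:
  fixes A :: "complex^'n^'n"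
  assumes A: "hermitian A" and M: "subspace M" and inv: "\<And>x. x \<in> M \<Longrightarrow> A *v x \<in> M"
    and ne: "M \<noteq> {0}"
  obtains x l where "x \<in> M" "norm x = 1" "A *v x = l *\<^sub>R x"
proof -
  let ?S = "M \<inter> sphere 0 1"
  obtain z where z: "z \<in> M" "z \<noteq> 0" using ne subspace_0[OF M] by blast
  have "(1 / norm z) *\<^sub>R z \<in> ?S"
    using z M by (simp add: subspace_scale)
  then have "?S \<noteq> {}" by blast
  moreover have "compact ?S" by (simp add: M closed_subspace closed_Int_compact)
  moreover have "continuous_on ?S (\<lambda>x. inner x (A *v x))"
    unfolding matrix_vector_mult_def by (intro continuous_intros)
  ultimately have "\<exists>x\<in>?S. \<forall>y\<in>?S. inner y (A *v y) \<le> inner x (A *v x)"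
    by (intro continuous_attains_sup)
  then obtain x where x: "x \<in> ?S" and max: "\<forall>y\<in>?S. inner y (A *v y) \<le> inner x (A *v x)"
    by (rule bexE)
  define l where "l = inner x (A *v x)"
  \<comment> \<open>The quadratic form of l I - A: by maximality and homogeneity it is nonnegative
    on \<open>M\<close>, and it vanishes at \<open>x\<close>, which therefore minimizes it
    there.\<close>
  define p where "p y = inner y (l *\<^sub>R y - A *v y)" for y
  have p_nonneg: "0 \<le> p y" if "y \<in> M" for y
  proof (cases "y = 0")
    case False
    have "(1 / norm y) *\<^sub>R y \<in> ?S" using that M False by (simp add: subspace_scale)
    from max[rule_format, OF this] have "inner y (A *v y) / (norm y)\<^sup>2 \<le> l"
      by (simp add: l_def matrix_vector_mult_scaleR power2_eq_square)
    then show ?thesis using False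
      by (simp add: p_def inner_diff_right divide_le_eq power2_norm_eq_inner)
  qed (simp add: p_def)
  have px: "p x = 0" using x by (simp add: p_def l_def inner_diff_right dot_square_norm)
  \<comment> \<open>Half the gradient of \<open>p\<close> at \<open>x\<close>. Invariance puts it
    into \<open>M\<close>, so \<open>x\<close> may be moved along it; the first-order change is then
    2t times \<open>inner w w\<close>, which must vanish.\<close>
  define w where "w = l *\<^sub>R x - A *v x"
  have wM: "w \<in> M" using x inv M by (simp add: w_def subspace_diff subspace_scale)
  have "inner w w = 0"
  proof (rule quadratic_nonneg_imp_linear_coeff_0[where p = "p w"])
    fix t :: real
    have s: "inner x (A *v w) = inner w (A *v x)"
      using hermitian_inner[OF A, of x w] by (simp add: inner_commute)
    have "inner w w = inner w (l *\<^sub>R x - A *v x)" by (simp only: w_def)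
    then have ww: "inner w w = l * inner x w - inner w (A *v x)"
      by (simp add: inner_diff_right inner_commute)
    have "p (x + t *\<^sub>R w) = p x + 2 * t * inner w w + t\<^sup>2 * p w"
      by (simp add: p_def matrix_vector_right_distrib matrix_vector_mult_scaleR inner_add_left
          inner_add_right inner_diff_right s ww inner_commute[of w x] algebra_simps power2_eq_square)
    moreover have "0 \<le> p (x + t *\<^sub>R w)"
      using x wM M by (intro p_nonneg) (simp add: subspace_add subspace_scale)
    ultimately show "0 \<le> 2 * t * inner w w + t\<^sup>2 * p w" using px by simp
  qed (use p_nonneg wM in auto)
  then have "A *v x = l *\<^sub>R x" by (simp add: w_def)
  with x show ?thesis by (intro that[of x l]) auto
qed

text \<open>Orthogonality for the complex inner product, expressed by the real inner product of the
  type class, which is its real part.\<close>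

definition corth :: "complex^'n \<Rightarrow> complex^'n \<Rightarrow> bool" where
  "corth x y \<longleftrightarrow> inner x y = 0 \<and> inner (\<i> *s x) y = 0"

text \<open>Replacing x by ix multiplies the Hermitian product by -i, so the two real conditions are
  its real and imaginary parts.\<close>

lemma corth_iff: "corth x y \<longleftrightarrow> (\<Sum>i\<in>UNIV. cnj (x $ i) * y $ i) = 0"
proof -
  have "inner (\<i> *s x) y = Im (\<Sum>i\<in>UNIV. cnj (x $ i) * y $ i)"
    by (simp add: inner_vec_def inner_complex_eq)
  moreover have "inner x y = Re (\<Sum>i\<in>UNIV. cnj (x $ i) * y $ i)"
    by (simp add: inner_vec_def inner_complex_eq)
  ultimately show ?thesis by (simp add: corth_def complex_eq_iff)
qed

lemma corth_commute: "corth x y \<longleftrightarrow> corth y x"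
proof -
  have "(\<Sum>i\<in>UNIV. cnj (y $ i) * x $ i) = cnj (\<Sum>i\<in>UNIV. cnj (x $ i) * y $ i)"
    by (simp add: mult.commute)
  then show ?thesis by (simp only: corth_iff complex_cnj_zero_iff)
qed

text \<open>Induction on the index set: the complex orthogonal complement of the eigenvectors found
  so far is invariant under A and nonzero as long as an index is left, so it contains a further
  eigenvector.\<close>

lemma hermitian_orthonormal_eigenvectors:
  fixes A :: "complex^'n^'n" and S :: "'n set"
  assumes "hermitian A"
  shows "\<exists>v d. \<forall>i\<in>S. norm (v i) = 1 \<and> A *v v i = (d i :: real) *\<^sub>R v i
           \<and> (\<forall>j\<in>S. i \<noteq> j \<longrightarrow> corth (v i) (v j))"
  using finite[of S]
proof (induction S rule: finite_induct)
  case (insert a S)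
  then obtain v d where vd: "\<And>i. i \<in> S \<Longrightarrow> norm (v i) = 1"
    "\<And>i. i \<in> S \<Longrightarrow> A *v v i = (d i :: real) *\<^sub>R v i"
    "\<And>i j. i \<in> S \<Longrightarrow> j \<in> S \<Longrightarrow> i \<noteq> j \<Longrightarrow> corth (v i) (v j)" by metis
  \<comment> \<open>Real orthogonality to this set is complex orthogonality to all
    \<open>v i\<close>.\<close>
  define T where "T = v ` S \<union> (\<lambda>i. \<i> *s v i) ` S"
  define M where "M = {x. \<forall>j\<in>S. corth (v j) x}"
  have M_eq: "M = {x. \<forall>y\<in>T. inner y x = 0}" by (auto simp: M_def T_def corth_def)
  \<comment> \<open>Dimensions are real: \<open>complex^'n\<close> has dimension 2n, and
    \<open>T\<close> has at most 2 |S| < 2n elements.\<close>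
  have "card T \<le> card S + card S"
    unfolding T_def by (meson add_mono card_Un_le card_image_le finite order_trans)
  moreover have "card S < CARD('n)"
    using insert.hyps by (intro psubset_card_mono) auto
  moreover have "dim T \<le> card T" by (intro dim_le_card') (simp add: T_def)
  ultimately have "dim T < DIM(complex^'n)" by simp
  from orthogonal_to_subspace_exists[OF this] obtain z where "z \<noteq> 0"
    and z: "\<And>y. y \<in> span T \<Longrightarrow> orthogonal z y" by blast
  have "inner y z = 0" if "y \<in> T" for y
    using z[OF span_base[OF that]] by (simp add: orthogonal_def inner_commute)
  then have "M \<noteq> {0}" using \<open>z \<noteq> 0\<close> by (auto simp: M_eq)
  moreover have "subspace M" by (auto simp: M_eq subspace_def inner_add_right)
  moreover have "A *v x \<in> M" if "x \<in> M" for x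
  proof -
    \<comment> \<open>A maps each element of \<open>T\<close> to a real multiple of itself; symmetry
      then moves A over to \<open>x\<close>.\<close>
    have "inner (A *v y) x = 0" if "y \<in> T" for y
      using that \<open>x \<in> M\<close> vd(2)
      by (auto simp: T_def M_def corth_def vector_scalar_commute)
        (simp add: inner_vec_def scaleR_sum_right[symmetric] sum_distrib_left[symmetric])
    then show ?thesis using hermitian_inner[OF assms] by (simp add: M_eq)
  qed
  ultimately obtain x l where x: "x \<in> M" "norm x = 1" "A *v x = l *\<^sub>R x"
    using hermitian_eigenvector_in_subspace[OF assms] by metis
  have "\<forall>j\<in>S. corth (v j) x \<and> corth x (v j)" using x by (simp add: M_def corth_commute)
  then show ?case
    using x vd insert.hyps
    by (intro exI[of _ "v(a := x)"] exI[of _ "d(a := l)"]) auto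
qed simp

text \<open>The columns of U are orthonormal eigenvectors: orthonormality makes U unitary, and the
  eigenvector equations say AU = UD.\<close>

theorem hermitian_spectral:
  fixes A :: "complex^'n^'n"
  assumes "hermitian A"
  obtains U d where "unitary U" "A = U ** diag_matrix d ** ctranspose U"
proof -
  obtain v :: "'n \<Rightarrow> complex^'n" and d where n: "\<And>i. norm (v i) = 1" and e: "\<And>i. A *v v i = (d i :: real) *\<^sub>R v i"
    and o: "\<And>i j. i \<noteq> j \<Longrightarrow> corth (v i) (v j)"
    using hermitian_orthonormal_eigenvectors[OF assms, of UNIV] by (metis UNIV_I)
  define U :: "complex^'n^'n" where "U = (\<chi> i j. v j $ i)"
  have "(\<Sum>k\<in>UNIV. cnj (v i $ k) * v i $ k) = 1" for i
  proof -
    have "inner (v i) (v i) = 1" using n[of i] by (simp add: norm_eq_1)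
    then show ?thesis
      by (simp add: complex_eq_iff inner_vec_def inner_complex_eq)
  qed
  then have 1: "ctranspose U ** U = mat 1"
    using o by (auto simp: vec_eq_iff matrix_matrix_mult_def ctranspose_def U_def mat_def corth_iff)
  then have 2: "U ** ctranspose U = mat 1" by (simp add: matrix_left_right_inverse)
  have "(A ** U) $ i $ j = (U ** diag_matrix d) $ i $ j" for i j
  proof -
    have "(A ** U) $ i $ j = (A *v v j) $ i"
      by (simp add: matrix_matrix_mult_def matrix_vector_mult_def U_def)
    then show ?thesis by (simp add: e mult_diag_matrix_nth U_def mult.commute flip: scaleR_conv_of_real)
  qed
  then have "A ** U = U ** diag_matrix d" by (simp add: vec_eq_iff)
  then have "A ** (U ** ctranspose U) = U ** diag_matrix d ** ctranspose U"
    by (simp add: matrix_mul_assoc)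
  then show ?thesis using that[of U d] 1 2 by (simp add: unitary_def)
qed

section \<open>Simultaneous diagonalization by congruence\<close>

text \<open>W = V* U intertwines the two diagonal matrices, so an entry of W can be nonzero only
  where the two eigenvalues agree. Hence W also intertwines their powers.\<close>

lemma mat_powr_unique:
  fixes U V :: "complex^'n^'n"
  assumes "unitary U" "unitary V" "\<And>i. 0 < d i" "\<And>i. 0 < e i"
    and eq: "U ** diag_matrix d ** ctranspose U = V ** diag_matrix e ** ctranspose V"
  shows "U ** diag_matrix (\<lambda>i. d i powr t) ** ctranspose U
    = V ** diag_matrix (\<lambda>i. e i powr t) ** ctranspose V"
proof -
  define W where "W = ctranspose V ** U"
  have U: "ctranspose U ** U = mat 1" "U ** ctranspose U = mat 1"
    and V: "ctranspose V ** V = mat 1" "V ** ctranspose V = mat 1"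
    using assms(1,2) by (simp_all add: unitary_def)
  have "W ** diag_matrix d
      = ctranspose V ** (U ** diag_matrix d ** ctranspose U) ** U"
    by (simp add: W_def flip: matrix_mul_assoc) (simp add: U)
  also have "\<dots> = ctranspose V ** (V ** diag_matrix e ** ctranspose V) ** U"
    by (simp only: eq)
  also have "\<dots> = diag_matrix e ** W"
    by (simp add: W_def matrix_mul_assoc V)
  finally have "W $ i $ j * complex_of_real (d j) = complex_of_real (e i) * W $ i $ j" for i j
    unfolding mult_diag_matrix_nth[symmetric] diag_matrix_mult_nth[symmetric] by (rule arg_cong)
  then have "W $ i $ j = 0 \<or> d j = e i" for i j
    using mult.commute[of "W $ i $ j" "complex_of_real (d j)"] by auto
  then have "W $ i $ j * complex_of_real (d j powr t) = complex_of_real (e i powr t) * W $ i $ j" for i j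
    by (cases "W $ i $ j = 0") (simp, metis mult.commute)
  then have W: "W ** diag_matrix (\<lambda>i. d i powr t) = diag_matrix (\<lambda>i. e i powr t) ** W"
    by (simp add: vec_eq_iff mult_diag_matrix_nth diag_matrix_mult_nth)
  have VW: "V ** W = U" and WU: "W ** ctranspose U = ctranspose V"
    by (simp add: W_def V matrix_mul_assoc, simp add: W_def U flip: matrix_mul_assoc)
  have "U ** diag_matrix (\<lambda>i. d i powr t) ** ctranspose U
      = V ** (W ** diag_matrix (\<lambda>i. d i powr t)) ** ctranspose U"
    by (simp add: VW matrix_mul_assoc)
  also have "\<dots> = V ** diag_matrix (\<lambda>i. e i powr t) ** (W ** ctranspose U)"
    by (simp add: W matrix_mul_assoc)
  finally show ?thesis by (simp add: WU)
qed

text \<open>Uniqueness justifies the definite description, so any positive diagonalization computes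
  the power.\<close>

lemma mat_powr_eq:
  assumes "unitary U" "\<And>i. 0 < d i" "A = U ** diag_matrix d ** ctranspose U"
  shows "mat_powr A t = U ** diag_matrix (\<lambda>i. d i powr t) ** ctranspose U"
  unfolding mat_powr_def
proof (rule the_equality)
  fix X assume "\<exists>U d. unitary U \<and> (\<forall>i. 0 < d i) \<and>
      A = U ** diag_matrix d ** ctranspose U \<and>
      X = U ** diag_matrix (\<lambda>i. d i powr t) ** ctranspose U"
  then obtain V e where V: "unitary V" "\<And>i. 0 < e i" "A = V ** diag_matrix e ** ctranspose V"
    and X: "X = V ** diag_matrix (\<lambda>i. e i powr t) ** ctranspose V" by blast
  show "X = U ** diag_matrix (\<lambda>i. d i powr t) ** ctranspose U"
    unfolding X using V assms by (intro mat_powr_unique) simp_all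
qed (use assms in blast)

lemma inner_diag_matrix: "inner x (diag_matrix d *v x) = (\<Sum>i\<in>UNIV. d i * (norm (x $ i))\<^sup>2)"
proof -
  have "(diag_matrix d *v x) $ i = d i *\<^sub>R x $ i" for i
    by (simp add: matrix_vector_mult_def diag_matrix_def mult_delta_left scaleR_conv_of_real)
  then show ?thesis by (simp add: inner_vec_def dot_square_norm)
qed

text \<open>Each \<open>d i\<close> is the value of the quadratic form at the i-th column of U,
  hence positive.\<close>

lemma pos_def_spectral:
  fixes A :: "complex^'n^'n"
  assumes "pos_def A"
  obtains U d where "unitary U" "\<And>i. 0 < d i" "A = U ** diag_matrix d ** ctranspose U"
proof -
  from assms obtain U d where U: "unitary U" and A: "A = U ** diag_matrix d ** ctranspose U"
    using hermitian_spectral unfolding pos_def_def by blast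
  have UU: "ctranspose U ** U = mat 1" using U by (simp add: unitary_def)
  have "0 < d i" for i
  proof -
    let ?e = "axis i 1 :: complex^'n"
    have e: "ctranspose U *v (U *v x) = x" for x
      by (simp add: matrix_vector_mul_assoc UU)
    then have "U *v ?e \<noteq> 0" by (metis axis_eq_0_iff matrix_vector_mult_0_right zero_neq_one)
    then have "0 < inner (U *v ?e) (A *v (U *v ?e))"
      using assms by (simp add: pos_def_def Re_quad_form)
    also have "\<dots> = inner ?e (diag_matrix d *v ?e)"
      by (simp add: A inner_ctranspose e flip: matrix_vector_mul_assoc)
    also have "\<dots> = d i"
    proof -
      have "(norm (?e $ k))\<^sup>2 = (if k = i then 1 else 0)" for k
        by (simp add: axis_def)
      then show ?thesis by (simp add: inner_diag_matrix mult_delta_right)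
    qed
    finally show ?thesis .
  qed
  with U A show ?thesis using that by blast
qed

section \<open>Congruences\<close>

lemma congruence_pos_def:
  fixes P A :: "complex^'n^'n"
  assumes "pos_def A" "Q ** P = mat 1"
  shows "pos_def (ctranspose P ** A ** P)"
proof -
  have "0 < Re (quad_form (ctranspose P ** A ** P) x)" if "x \<noteq> 0" for x
  proof -
    have "Q *v (P *v x) = x" by (simp add: matrix_vector_mul_assoc assms(2))
    then have "P *v x \<noteq> 0" using that by (metis matrix_vector_mult_0_right)
    then have "0 < inner (P *v x) (A *v (P *v x))"
      using assms(1) by (simp add: pos_def_def Re_quad_form)
    also have "\<dots> = Re (quad_form (ctranspose P ** A ** P) x)"
      by (simp add: Re_quad_form inner_ctranspose flip: matrix_vector_mul_assoc)
    finally show ?thesis .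
  qed
  moreover have "hermitian (ctranspose P ** A ** P)"
    using assms(1) by (simp add: pos_def_def hermitian_def ctranspose_mult matrix_mul_assoc)
  ultimately show ?thesis by (simp add: pos_def_def)
qed

lemma congruence_diag_pos_semidef:
  fixes K :: "complex^'n^'n"
  assumes "\<And>i. 0 \<le> g i"
  shows "pos_semidef (K ** diag_matrix g ** ctranspose K)"
proof -
  have "0 \<le> inner x ((K ** diag_matrix g ** ctranspose K) *v x)" for x
  proof -
    have "0 \<le> inner (ctranspose K *v x) (diag_matrix g *v (ctranspose K *v x))"
      unfolding inner_diag_matrix by (intro sum_nonneg mult_nonneg_nonneg assms) simp
    then show ?thesis by (simp add: inner_ctranspose flip: matrix_vector_mul_assoc)
  qed
  then show ?thesis
    by (simp add: pos_semidef_def Re_quad_form hermitian_def ctranspose_mult matrix_mul_assoc)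
qed

lemma congruence_diag_nth:
  "(K ** diag_matrix g ** ctranspose K) $ i $ j
    = (\<Sum>k\<in>UNIV. g k *\<^sub>R (K $ i $ k * cnj (K $ j $ k)))"
  unfolding matrix_matrix_mult_def[of "K ** diag_matrix g"]
  by (simp add: mult_diag_matrix_nth ctranspose_def scaleR_conv_of_real mult_ac)

text \<open>Real linearity in g for fixed K lets a linear combination of such matrices be computed
  entry by entry on the diagonals.\<close>

lemma congruence_diag_linear:
  fixes K :: "complex^'n^'n"
  defines "F \<equiv> \<lambda>g. K ** diag_matrix g ** ctranspose K"
  shows congruence_diag_add: "F g + F h = F (\<lambda>i. g i + h i)"
    and congruence_diag_diff: "F g - F h = F (\<lambda>i. g i - h i)"
    and congruence_diag_scaleR: "c *\<^sub>R F g = F (\<lambda>i. c * g i)"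
    and congruence_diag_sum: "(\<Sum>j\<in>J. F (G j)) = F (\<lambda>i. \<Sum>j\<in>J. G j i)"
proof -
  show "F g + F h = F (\<lambda>i. g i + h i)" "F g - F h = F (\<lambda>i. g i - h i)"
    "c *\<^sub>R F g = F (\<lambda>i. c * g i)"
    by (simp_all add: F_def vec_eq_iff congruence_diag_nth scaleR_add_left scaleR_diff_left
        sum.distrib sum_subtractf scaleR_sum_right)
  show "(\<Sum>j\<in>J. F (G j)) = F (\<lambda>i. \<Sum>j\<in>J. G j i)"
    unfolding F_def vec_eq_iff sum_component congruence_diag_nth scaleR_sum_left
    by (intro allI sum.swap)
qed

text \<open>Take K = A^(1/2) V, where the unitary V diagonalizes A^(-1/2) B A^(-1/2) with
  eigenvalues \<open>d i\<close>. One K serves all t, because only the inner power in the geometric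
  mean depends on t.\<close>

lemma simultaneous_diagonalization:
  fixes A B :: "complex^'n^'n"
  assumes "pos_def A" "pos_def B"
  obtains K :: "complex^'n^'n" and d where "\<And>i. 0 < d i"
    "A = K ** diag_matrix (\<lambda>_. 1) ** ctranspose K"
    "B = K ** diag_matrix d ** ctranspose K"
    "\<And>t. A \<sharp>\<^bsub>t\<^esub> B = K ** diag_matrix (\<lambda>i. d i powr t) ** ctranspose K"
proof -
  obtain U :: "complex^'n^'n" and a where U: "unitary U" and a: "\<And>i. 0 < a i"
    and A: "A = U ** diag_matrix a ** ctranspose U"
    using pos_def_spectral[OF assms(1)] by blast
  have UU: "ctranspose U ** U = mat 1" "U ** ctranspose U = mat 1"
    using U by (simp_all add: unitary_def)
  note pw = mat_powr_eq[OF U a A]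
  define P Q where "P = mat_powr A (1/2)" and "Q = mat_powr A (-1/2)"
  \<comment> \<open>All powers of A share the eigenbasis U, so the exponent law reduces to the
    scalar one.\<close>
  have mult: "mat_powr A s ** mat_powr A t = mat_powr A (s + t)" for s t
  proof -
    have "diag_matrix (\<lambda>i. a i powr s) ** diag_matrix (\<lambda>i. a i powr t)
        = (diag_matrix (\<lambda>i. a i powr (s + t)) :: complex^'n^'n)"
      unfolding vec_eq_iff mult_diag_matrix_nth by (simp add: diag_matrix_def powr_add)
    then have "diag_matrix (\<lambda>i. a i powr s) ** (diag_matrix (\<lambda>i. a i powr t) ** X)
        = diag_matrix (\<lambda>i. a i powr (s + t)) ** X" for X :: "complex^'n^'n"
      by (simp add: matrix_mul_assoc)
    moreover have "ctranspose U ** (U ** X) = X" for X :: "complex^'n^'n"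
      by (simp add: matrix_mul_assoc UU)
    ultimately show ?thesis
      by (simp add: pw flip: matrix_mul_assoc)
  qed
  have p0: "mat_powr A 0 = mat 1"
  proof -
    \<comment> \<open>Since \<open>0 powr 0 = 0\<close>, positivity of the eigenvalues enters
      here.\<close>
    have "diag_matrix (\<lambda>i. a i powr 0) = (mat 1 :: complex^'n^'n)"
      using a by (auto simp: diag_matrix_def mat_def vec_eq_iff less_imp_neq[THEN not_sym])
    then show ?thesis by (simp add: pw UU)
  qed
  have p1: "mat_powr A 1 = A"
    using a by (simp add: pw[of 1] less_imp_le flip: A)
  have herm: "ctranspose (mat_powr A t) = mat_powr A t" for t
    by (simp add: pw ctranspose_mult matrix_mul_assoc)
  have PP: "P ** P = A" and PQ: "P ** Q = mat 1" and QP: "Q ** P = mat 1"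
    by (simp_all add: P_def Q_def mult p0 p1)
  have "pos_def (Q ** B ** Q)"
    using congruence_pos_def[OF assms(2) PQ] by (simp add: Q_def herm)
  then obtain V :: "complex^'n^'n" and d where V: "unitary V" and d: "\<And>i. 0 < d i"
    and QBQ: "Q ** B ** Q = V ** diag_matrix d ** ctranspose V"
    using pos_def_spectral by blast
  let ?K = "P ** V"
  have K: "?K ** D ** ctranspose ?K = P ** (V ** D ** ctranspose V) ** P" for D
    by (simp add: ctranspose_mult P_def herm matrix_mul_assoc)
  have "diag_matrix (\<lambda>_. 1) = (mat 1 :: complex^'n^'n)"
    by (simp add: diag_matrix_def mat_def vec_eq_iff)
  then have "A = ?K ** diag_matrix (\<lambda>_. 1) ** ctranspose ?K"
    unfolding K using V PP by (simp add: unitary_def)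
  moreover have "P ** (Q ** B ** Q) ** P = B"
  proof -
    have "P ** (Q ** X) = X" for X :: "complex^'n^'n"
      by (simp add: matrix_mul_assoc PQ)
    then show ?thesis by (simp add: QP flip: matrix_mul_assoc)
  qed
  then have "B = ?K ** diag_matrix d ** ctranspose ?K"
    by (simp add: K QBQ)
  moreover have "A \<sharp>\<^bsub>t\<^esub> B = ?K ** diag_matrix (\<lambda>i. d i powr t) ** ctranspose ?K" for t
    unfolding K geom_mean_def P_def[symmetric] Q_def[symmetric]
    by (simp add: mat_powr_eq[OF V d QBQ])
  ultimately show ?thesis by (rule that[OF d])
qed

theorem theorem4p1:
  fixes A B :: "complex^'n^'n" and N :: nat and \<nu> :: real
  assumes "pos_def A" and "pos_def B"
    and "N \<ge> 1"
    and "0 \<le> \<nu>" and "\<nu> \<le> 1"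
  shows "A \<sharp>\<^bsub>\<nu>\<^esub> B
      + (\<Sum>j=1..N. s_coeff j \<nu> *\<^sub>R
          (A \<sharp>\<^bsub>alpha j \<nu>\<^esub> B
           + A \<sharp>\<^bsub>2 powi (1 - int j) + alpha j \<nu>\<^esub> B
           - 2 *\<^sub>R (A \<sharp>\<^bsub>2 powi (- int j) + alpha j \<nu>\<^esub> B)))
    \<preceq>\<^sub>L A \<nabla>\<^bsub>\<nu>\<^esub> B"
proof -
  obtain K :: "complex^'n^'n" and d where d: "\<And>i. 0 < d i"
    and A: "A = K ** diag_matrix (\<lambda>_. 1) ** ctranspose K"
    and B: "B = K ** diag_matrix d ** ctranspose K"
    and G: "\<And>t. A \<sharp>\<^bsub>t\<^esub> B = K ** diag_matrix (\<lambda>i. d i powr t) ** ctranspose K"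
    using simultaneous_diagonalization[OF assms(1,2)] by blast
  have M: "A \<nabla>\<^bsub>\<nu>\<^esub> B = K ** diag_matrix (\<lambda>i. (1 - \<nu>) * 1 + \<nu> * d i) ** ctranspose K"
    unfolding arith_mean_def
    by (subst A, subst B) (simp only: congruence_diag_scaleR congruence_diag_add)
  \<comment> \<open>The diagonal entries 1 of A and \<open>d i\<close> of B are the values of
    \<open>d i powr t\<close> at t = 0 and t = 1, the end values in the scalar bound.\<close>
  have "d i powr 0 = 1" "d i powr 1 = d i" for i
    using d[of i] by simp_all
  then have "d i powr \<nu> + (\<Sum>j=1..N. s_coeff j \<nu> *
      (d i powr alpha j \<nu> + d i powr (2 powi (1 - int j) + alpha j \<nu>)
       - 2 * d i powr (2 powi (- int j) + alpha j \<nu>))) \<le> (1 - \<nu>) * 1 + \<nu> * d i" for i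
    using dyadic_convex_le[OF convex_on_powr_exponent[OF d[of i]] assms(4,5), of N] by simp
  \<comment> \<open>By linearity the difference of the two sides is K diag(g) K*, where g is the
    nonnegative gap in the scalar inequality.\<close>
  then show ?thesis
    unfolding loewner_le_def M G congruence_diag_scaleR congruence_diag_add
      congruence_diag_diff congruence_diag_sum
    by (intro congruence_diag_pos_semidef) (simp only: diff_ge_0_iff_ge)
qed

end
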